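(* Let $n\in\mathbb{N}$, let $\frac1T\in\mathbb{N}$ with $T<\frac12$, $p=\frac nT$, $x_k=kT$, let $a,\phi\in\mathbb{R}$, and let $f\in\left\{\frac1n,\frac2n,\ldots,1-\frac1n\right\}$. Consider the vectors in $\mathbb{R}^p$ $$s=\big[\cos(2\pi x_k)+a\cos(2\pi f x_k+\phi)\big]_{k=0}^{p-1},\qquad s_{HF}=\big[\cos(2\pi x_k)\big]_{k=0}^{p-1}.$$ Let $w_L$ be a doubly convolved discrete periodic filter of length $2L+1$ sample points, with associated circulant convolution matrix $W=UDU^{*}\in\mathbb{R}^{p\times p}$, such that the smallest positive zero of the DFT of $w_L$ corresponds to frequency $1$, i.e. $\lambda_n=0$ and $\lambda_j\ne0$ for $1\le j<n$. Then for every $\eta>0$ and every $\delta>0$ there exists an integer $\widetilde{N_0}>0$ such that the stopping criterion $$\big\|(I-W)^{m+1}s-(I-W)^m s\big\|_2<\delta\qquad\text{for all } m\ge\widetilde{N_0}$$ is satisfied and $\overline{\mathrm{IMF}}_1=U(I-D)^{\widetilde{N_0}}U^{*}s=(I-W)^{\widetilde{N_0}}s$ satisfies $$\big\|\overline{\mathrm{IMF}}_1-s_{HF}\big\|_2<\eta.$$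
   Context: A discrete periodic filter is a real, nonnegative vector $w=(w(q))_{q\in\mathbb{Z}/p\mathbb{Z}}$ that is even ($w(-q)=w(q)$) with $\sum_q w(q)=1$; it has length $2L+1$ ($2L+1\le p$) if it is supported on residues of $-L,\ldots,L$. It is doubly convolved if $w=h\ast h$ (circular convolution) for some discrete periodic filter $h$. The associated convolution matrix is the circulant matrix $W=[w(i-j)]_{i,j=0}^{p-1}$. Its eigenvalues are the DFT values $\lambda_j=\sum_{q=0}^{p-1}w(q)e^{-2\pi i jq/p}$, $j=0,\ldots,p-1$, with orthonormal eigenvectors $u_j=\frac1{\sqrt p}\big[1,e^{-2\pi i j/p},\ldots,e^{-2\pi i j(p-1)/p}\big]^T$; $U$ is the unitary matrix with columns $u_j$ and $D=\mathrm{diag}(\lambda_0,\ldots,\lambda_{p-1})$. The signal has duration $n$ seconds sampled at rate $1/T$, so DFT index $j$ corresponds to frequency $j/n$. The Discrete Iterative Filtering inner loop with fixed filter computes the iterates $(I-W)^m s$. *)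

theory Defs
  imports
    Complex_Main
    "HOL-Number_Theory.Cong"
    "HOL-Analysis.L2_Norm"
    "Jordan_Normal_Form.Schur_Decomposition"
begin

text \<open>Functions on the residues modulo p are represented by p-periodic functions on the integers.\<close>

definition discrete_periodic_filter :: "nat \<Rightarrow> (int \<Rightarrow> real) \<Rightarrow> bool" where
  "discrete_periodic_filter p w \<longleftrightarrow>
     (\<forall>q. w (q + int p) = w q) \<and>
     (\<forall>q. 0 \<le> w q) \<and>
     (\<forall>q. w (- q) = w q) \<and>
     (\<Sum>q = 0..<int p. w q) = 1"

text \<open>Here L is the half-length: the support has at most 2 * L + 1 residues.\<close>

definition has_filter_length :: "nat \<Rightarrow> nat \<Rightarrow> (int \<Rightarrow> real) \<Rightarrow> bool" where
  "has_filter_length p L w \<longleftrightarrow>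
     2 * L + 1 \<le> p \<and>
     (\<forall>q. w q \<noteq> 0 \<longrightarrow> (\<exists>r\<in>{- int L..int L}. [q = r] (mod int p)))"

definition circular_convolution ::
  "nat \<Rightarrow> (int \<Rightarrow> real) \<Rightarrow> (int \<Rightarrow> real) \<Rightarrow> int \<Rightarrow> real" where
  "circular_convolution p g h q = (\<Sum>r = 0..<int p. g r * h (q - r))"

definition doubly_convolved :: "nat \<Rightarrow> (int \<Rightarrow> real) \<Rightarrow> bool" where
  "doubly_convolved p w \<longleftrightarrow>
     (\<exists>h. discrete_periodic_filter p h \<and> w = circular_convolution p h h)"

definition convolution_matrix :: "nat \<Rightarrow> (int \<Rightarrow> real) \<Rightarrow> real mat" where
  "convolution_matrix p w = Matrix.mat p p (\<lambda>(i, j). w (int i - int j))"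

definition dft :: "nat \<Rightarrow> (int \<Rightarrow> real) \<Rightarrow> nat \<Rightarrow> complex" where
  "dft p w j =
     (\<Sum>q<p. complex_of_real (w (int q)) *
        exp (- (2 * complex_of_real pi * \<i> * of_nat j * of_nat q / of_nat p)))"

text \<open>The matrix whose j-th column is the normalised eigenvector belonging to \<^term>\<open>dft p w j\<close>.\<close>

definition fourier_matrix :: "nat \<Rightarrow> complex mat" where
  "fourier_matrix p = Matrix.mat p p (\<lambda>(k, j).
     exp (- (2 * complex_of_real pi * \<i> * of_nat j * of_nat k / of_nat p)) /
     complex_of_real (sqrt (real p)))"

definition dft_diagonal :: "nat \<Rightarrow> (int \<Rightarrow> real) \<Rightarrow> complex mat" where
  "dft_diagonal p w = mat_diag p (dft p w)"

definition euclidean_norm :: "real vec \<Rightarrow> real" where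
  "euclidean_norm v = L2_set (vec_index v) {..<dim_vec v}"

end

theory Submission
  imports Defs
begin

text \<open>
  Since \<^term>\<open>w\<close> is real and even, a cosine whose frequency is a multiple of \<open>2 * pi / p\<close>
  is an eigenvector of the convolution matrix, with the real eigenvalue \<open>dft p w j\<close>, whatever its
  phase. Since \<^term>\<open>w\<close> is doubly convolved, the eigenvalue is a square, and since the weights sum
  to 1 it is at most 1. With \<open>p = n / T\<close> the two components of the signal are cosines of
  index \<open>n\<close> (eigenvalue 0) and of some index \<open>1 \<le> j < n\<close> (eigenvalue \<open>c\<close> with \<open>0 < c \<le> 1\<close>).
  Hence \<open>I - W\<close> fixes the first component and contracts the second by the factor
  \<open>1 - c < 1\<close> in every step.
\<close>

section \<open>Periodic functions on the integers and their sums over one period\<close>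

lemma periodic_add_multiple:
  fixes g :: "int \<Rightarrow> 'a"
  assumes "\<And>q. g (q + int p) = g q"
  shows "g (q + int p * k) = g q"
proof (induction k rule: int_induct[where k = 0])
  case (step1 i)
  then show ?case using assms[of "q + int p * i"] by (simp add: algebra_simps)
next
  case (step2 i)
  then show ?case using assms[of "q + int p * (i - 1)"] by (simp add: algebra_simps)
qed simp

lemma periodic_mod:
  fixes g :: "int \<Rightarrow> 'a"
  assumes "\<And>q. g (q + int p) = g q"
  shows "g (q mod int p) = g q"
  using periodic_add_multiple[of g p "q mod int p" "q div int p", OF assms] by simp

text \<open>The map \<open>q \<mapsto> (i - q) mod p\<close> is an involution of the residues
  \<open>0..<p\<close>, hence its own inverse in the reindexing, and periodicity absorbs the
  \<open>mod\<close>.\<close>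

lemma sum_periodic_reflect:
  fixes g :: "int \<Rightarrow> 'a :: comm_monoid_add"
  assumes "\<And>q. g (q + int p) = g q"
  shows "(\<Sum>q = 0..<int p. g (i - q)) = (\<Sum>q = 0..<int p. g q)"
  by (rule sum.reindex_bij_witness[where i = "\<lambda>q. (i - q) mod int p"
        and j = "\<lambda>q. (i - q) mod int p"])
    (auto simp: periodic_mod[of g p, OF assms] mod_simps)

lemma sum_periodic_shift:
  fixes g :: "int \<Rightarrow> 'a :: comm_monoid_add"
  assumes "\<And>q. g (q + int p) = g q"
  shows "(\<Sum>q = 0..<int p. g (q + r)) = (\<Sum>q = 0..<int p. g q)"
  by (rule sum.reindex_bij_witness[where i = "\<lambda>q. (q - r) mod int p"
        and j = "\<lambda>q. (q + r) mod int p"])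
    (auto simp: periodic_mod[of g p, OF assms] mod_simps)

text \<open>Bridges the natural-number indices of matrices and of \<open>dft\<close> to the integer
  ranges on which reflections and shifts act.\<close>

lemma sum_lessThan_int: "(\<Sum>q<p. g (int q)) = (\<Sum>q = 0..<int p. g q)"
  by (rule sum.reindex_bij_witness[where i = nat and j = int]) auto

section \<open>Discrete Fourier modes as characters of the integers, and their orthogonality\<close>

definition fourier_mode :: "nat \<Rightarrow> nat \<Rightarrow> int \<Rightarrow> complex" where
  "fourier_mode p j q = cis (- (2 * pi * real j * of_int q / real p))"

lemma fourier_mode_0 [simp]: "fourier_mode p j 0 = 1"
  by (simp add: fourier_mode_def)

lemma fourier_mode_add: "fourier_mode p j (q + r) = fourier_mode p j q * fourier_mode p j r"
  by (simp add: fourier_mode_def cis_mult add_divide_distrib algebra_simps)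

lemma cnj_fourier_mode: "cnj (fourier_mode p j q) = fourier_mode p j (- q)"
  by (simp add: fourier_mode_def cis_cnj)

lemma norm_fourier_mode [simp]: "cmod (fourier_mode p j q) = 1"
  by (simp add: fourier_mode_def)

lemma fourier_mode_periodic:
  assumes "p > 0"
  shows "fourier_mode p j (q + int p) = fourier_mode p j q"
proof -
  have "fourier_mode p j (int p) = cis (2 * pi * (- real j))"
    using assms by (simp add: fourier_mode_def)
  also have "\<dots> = 1" by (rule cis_multiple_2pi) simp
  finally show ?thesis by (simp add: fourier_mode_add)
qed

lemma exp_eq_fourier_mode:
  "exp (- (2 * complex_of_real pi * \<i> * of_nat j * of_nat q / of_nat p)) = fourier_mode p j (int q)"
  by (simp add: fourier_mode_def cis_conv_exp algebra_simps)

lemma dft_eq_fourier_mode: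
  "dft p w j = (\<Sum>q = 0..<int p. complex_of_real (w q) * fourier_mode p j q)"
  by (simp add: dft_def exp_eq_fourier_mode sum_lessThan_int[symmetric])

text \<open>For \<open>j \<noteq> l\<close> the summand is a \<open>p\<close>-periodic character
  \<open>g\<close>. Shifting by one leaves its sum over a period unchanged but also multiplies it by
  \<open>g 1\<close>, so the sum vanishes because \<open>g 1 \<noteq> 1\<close>.\<close>

lemma fourier_mode_orthogonal:
  assumes "j < p" "l < p"
  shows "(\<Sum>q = 0..<int p. fourier_mode p j q * cnj (fourier_mode p l q)) =
    (if j = l then of_nat p else 0)"
proof (cases "j = l")
  case True
  then show ?thesis by (simp add: complex_norm_square[symmetric])
next
  case False
  define g where "g q = fourier_mode p j q * cnj (fourier_mode p l q)" for q
  have "g (q + int p) = g q" for q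
    using assms by (simp add: g_def fourier_mode_periodic)
  then have "(\<Sum>q = 0..<int p. g (q + 1)) = (\<Sum>q = 0..<int p. g q)"
    by (rule sum_periodic_shift)
  moreover have "g (q + 1) = g 1 * g q" for q
    by (simp add: g_def fourier_mode_add)
  ultimately have eq: "g 1 * (\<Sum>q = 0..<int p. g q) = (\<Sum>q = 0..<int p. g q)"
    by (simp add: sum_distrib_left)
  \<comment> \<open>If \<open>g 1 = 1\<close>, its angle is a multiple of \<open>2 * pi\<close>, so
    \<open>p\<close> divides \<open>l - j\<close>; this is impossible for distinct indices below
    \<open>p\<close>.\<close>
  have "g 1 \<noteq> 1"
  proof
    assume "g 1 = 1"
    moreover have "g 1 = cis (2 * pi * (real l - real j) / real p)"
      by (simp add: g_def fourier_mode_def cis_cnj cis_mult right_diff_distrib diff_divide_distrib)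
    ultimately have "cos (2 * pi * (real l - real j) / real p) = 1"
      by (simp add: complex_eq_iff)
    then obtain k :: int where "2 * pi * (real l - real j) / real p = of_int k * 2 * pi"
      using cos_one_2pi_int by auto
    then have "2 * pi * (real l - real j) = 2 * pi * (of_int k * real p)"
      using assms by (simp add: divide_eq_eq)
    then have "real l - real j = of_int k * real p"
      using mult_left_cancel[of "2 * pi"] by simp
    then have "int l - int j = k * int p"
      by (metis of_int_diff of_int_eq_iff of_int_mult of_int_of_nat_eq)
    then have "int p dvd int l - int j" by simp
    then have "int l mod int p = int j mod int p" by (simp add: mod_eq_dvd_iff)
    with assms False show False by simp
  qed
  with eq have "(\<Sum>q = 0..<int p. g q) = 0" by simp
  with False show ?thesis by (simp add: g_def)
qed

section \<open>Unitarity of the Fourier matrix\<close>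

lemma fourier_matrix_eq:
  "fourier_matrix p =
     Matrix.mat p p (\<lambda>(k, j). fourier_mode p j (int k) / complex_of_real (sqrt (real p)))"
  by (simp add: fourier_matrix_def exp_eq_fourier_mode)

lemma fourier_matrix_carrier [simp]: "fourier_matrix p \<in> carrier_mat p p"
  by (simp add: fourier_matrix_def)

lemma mat_adjoint_carrier:
  assumes "A \<in> carrier_mat n n"
  shows "mat_adjoint A \<in> carrier_mat n n"
  using assms by (auto simp: mat_adjoint_def)

lemma index_mat_adjoint:
  assumes "A \<in> carrier_mat n n" "i < n" "j < n"
  shows "mat_adjoint A $$ (i, j) = conjugate (A $$ (j, i))"
  using assms by (simp add: mat_adjoint_def mat_of_rows_index)

text \<open>Each entry of the product is an inner product of two columns; the two normalising
  factors combine to \<open>1 / p\<close>, which cancels the value \<open>p\<close> on the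
  diagonal.\<close>

lemma fourier_matrix_unitary:
  assumes "p > 0"
  shows "mat_adjoint (fourier_matrix p) * fourier_matrix p = 1\<^sub>m p"
proof (rule eq_matI)
  let ?U = "fourier_matrix p"
  fix i j assume "i < dim_row (1\<^sub>m p)" "j < dim_col (1\<^sub>m p)"
  then have ij: "i < p" "j < p" by auto
  have "(mat_adjoint ?U * ?U) $$ (i, j) =
      (\<Sum>q<p. mat_adjoint ?U $$ (i, q) * ?U $$ (q, j))"
    using ij mat_adjoint_carrier[OF fourier_matrix_carrier, of p]
    by (auto simp: scalar_prod_def atLeast0LessThan fourier_matrix_def)
  also have "\<dots> = (\<Sum>q<p. fourier_mode p j (int q) * cnj (fourier_mode p i (int q)) / of_nat p)"
  proof (rule sum.cong)
    fix q assume q: "q \<in> {..<p}"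
    have "complex_of_real (sqrt (real p)) * complex_of_real (sqrt (real p)) = of_nat p"
      by (simp flip: of_real_mult)
    moreover have "mat_adjoint ?U $$ (i, q) = cnj (?U $$ (q, i))"
      using q ij by (simp add: index_mat_adjoint[OF fourier_matrix_carrier])
    ultimately show "mat_adjoint ?U $$ (i, q) * ?U $$ (q, j) =
        fourier_mode p j (int q) * cnj (fourier_mode p i (int q)) / of_nat p"
      using q ij by (simp add: fourier_matrix_eq mult.commute)
  qed simp
  also have "\<dots> = (\<Sum>q = 0..<int p. fourier_mode p j q * cnj (fourier_mode p i q)) / of_nat p"
    by (simp only: sum_divide_distrib sum_lessThan_int[symmetric])
  also have "\<dots> = 1\<^sub>m p $$ (i, j)"
    using ij assms by (auto simp: fourier_mode_orthogonal)
  finally show "(mat_adjoint ?U * ?U) $$ (i, j) = 1\<^sub>m p $$ (i, j)" .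
qed (use mat_adjoint_carrier[OF fourier_matrix_carrier, of p] in \<open>auto simp: fourier_matrix_def\<close>)

section \<open>The spectrum of a discrete periodic filter\<close>

context
  fixes p :: nat and w :: "int \<Rightarrow> real"
  assumes p: "p > 0" and w: "discrete_periodic_filter p w"
begin

lemma filter_periodic: "w (q + int p) = w q"
  and filter_nonneg: "0 \<le> w q"
  and filter_even: "w (- q) = w q"
  and filter_sum: "(\<Sum>q = 0..<int p. w q) = 1"
  using w by (auto simp: discrete_periodic_filter_def)

text \<open>Conjugation reflects the modes and evenness lets \<open>w\<close> be reflected along
  with them, so the conjugate is the same sum over one period traversed backwards.\<close>

lemma cnj_dft_filter: "cnj (dft p w j) = dft p w j"
proof -
  have "cnj (dft p w j) = (\<Sum>q = 0..<int p. complex_of_real (w (0 - q)) * fourier_mode p j (0 - q))"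
    by (simp add: dft_eq_fourier_mode cnj_fourier_mode filter_even)
  also have "\<dots> = dft p w j"
    unfolding dft_eq_fourier_mode
    by (rule sum_periodic_reflect) (simp add: filter_periodic fourier_mode_periodic p)
  finally show ?thesis .
qed

lemma dft_filter_real: "dft p w j = complex_of_real (Re (dft p w j))"
  using cnj_dft_filter[of j] by (simp add: complex_eq_iff)

text \<open>Triangle inequality: the modes have modulus 1, and the nonnegative weights sum to
  1.\<close>

lemma dft_filter_le_1: "Re (dft p w j) \<le> 1"
proof -
  have "Re (dft p w j) \<le> cmod (dft p w j)" by (rule complex_Re_le_cmod)
  also have "\<dots> \<le> (\<Sum>q = 0..<int p. cmod (complex_of_real (w q) * fourier_mode p j q))"
    unfolding dft_eq_fourier_mode by (rule norm_sum)
  also have "\<dots> = 1" by (simp add: norm_mult filter_nonneg filter_sum)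
  finally show ?thesis .
qed

text \<open>Says that each mode is an eigenvector of convolution with \<open>w\<close>. Substituting
  \<open>q = i - r\<close> and splitting the mode at \<open>i - q\<close> pulls out the factor at
  \<open>i\<close>.\<close>

lemma filter_convolve_mode:
  "(\<Sum>r = 0..<int p. complex_of_real (w (i - r)) * fourier_mode p j r) =
     dft p w j * fourier_mode p j i"
proof -
  define g where "g q = complex_of_real (w q) * fourier_mode p j (i - q)" for q
  have per: "g (q + int p) = g q" for q
  proof -
    have "fourier_mode p j (i - q) = fourier_mode p j (i - (q + int p))"
      using fourier_mode_periodic[OF p, of j "i - (q + int p)"] by simp
    then show ?thesis by (simp add: g_def filter_periodic)
  qed
  have "(\<Sum>r = 0..<int p. complex_of_real (w (i - r)) * fourier_mode p j r) =
      (\<Sum>r = 0..<int p. g (i - r))"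
    by (simp add: g_def)
  also have "\<dots> = (\<Sum>q = 0..<int p. g q)"
    by (rule sum_periodic_reflect) (rule per)
  \<comment> \<open>The remaining modes are taken at \<open>- q\<close>, so the conjugate of the DFT
    appears first; realness removes the conjugation.\<close>
  also have "\<dots> = cnj (dft p w j) * fourier_mode p j i"
    using fourier_mode_add[of p j i "- q" for q]
    by (simp add: g_def dft_eq_fourier_mode cnj_fourier_mode sum_distrib_left mult_ac)
  finally show ?thesis by (simp only: cnj_dft_filter)
qed

text \<open>A real eigenvalue commutes with taking real parts, so the eigenvector equation passes
  from the complex mode, multiplied by any constant phase, to the cosine.\<close>

lemma filter_convolve_cos:
  "(\<Sum>k<p. w (int i - int k) * cos (2 * pi * real j * real k / real p + \<phi>)) =
     Re (dft p w j) * cos (2 * pi * real j * real i / real p + \<phi>)"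
proof -
  \<comment> \<open>The modes carry the negative sign of the DFT, so the phase enters as
    \<open>- \<phi>\<close> and evenness of the cosine restores the sign.\<close>
  have cos_eq: "cos (2 * pi * real j * real k / real p + \<phi>) =
      Re (cis (- \<phi>) * fourier_mode p j (int k))" for k
    unfolding fourier_mode_def cis_mult cis.sel
    by (subst cos_minus[symmetric]) (simp add: add.commute)
  have "(\<Sum>k<p. w (int i - int k) * cos (2 * pi * real j * real k / real p + \<phi>)) =
      Re (cis (- \<phi>) * (\<Sum>k<p. complex_of_real (w (int i - int k)) * fourier_mode p j (int k)))"
    unfolding cos_eq sum_distrib_left Re_sum
    by (rule sum.cong) (simp_all add: algebra_simps)
  also have "\<dots> = Re (cis (- \<phi>) * (complex_of_real (Re (dft p w j)) * fourier_mode p j (int i)))"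
    unfolding sum_lessThan_int[of "\<lambda>k. complex_of_real (w (int i - k)) * fourier_mode p j k"]
      filter_convolve_mode dft_filter_real[symmetric] ..
  also have "\<dots> = Re (dft p w j) * Re (cis (- \<phi>) * fourier_mode p j (int i))"
    by (simp add: algebra_simps)
  finally show ?thesis by (simp only: cos_eq)
qed

text \<open>Evenness rewrites \<open>w (q - r)\<close> as \<open>w (r - q)\<close>; after exchanging
  the sums, the inner one is \<open>filter_convolve_mode\<close>, and the outer one yields the
  second factor.\<close>

lemma dft_self_convolution: "dft p (circular_convolution p w w) j = (dft p w j)\<^sup>2"
proof -
  have "dft p (circular_convolution p w w) j =
      (\<Sum>q = 0..<int p. \<Sum>r = 0..<int p.
        complex_of_real (w r) * (complex_of_real (w (r - q)) * fourier_mode p j q))"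
    using filter_even[of "r - q" for r q]
    by (simp add: dft_eq_fourier_mode circular_convolution_def sum_distrib_left mult_ac)
  also have "\<dots> = (\<Sum>r = 0..<int p. complex_of_real (w r) * (dft p w j * fourier_mode p j r))"
    by (subst sum.swap) (simp only: sum_distrib_left[symmetric] filter_convolve_mode)
  also have "\<dots> = (dft p w j)\<^sup>2"
    by (simp add: dft_eq_fourier_mode power2_eq_square sum_distrib_left mult_ac)
  finally show ?thesis .
qed

section \<open>Eigenvectors and unitary diagonalisation of the convolution matrix\<close>

lemma convolution_matrix_carrier: "convolution_matrix p w \<in> carrier_mat p p"
  by (simp add: convolution_matrix_def)

lemma convolution_matrix_mult_cos:
  "convolution_matrix p w *\<^sub>v Matrix.vec p (\<lambda>k. cos (2 * pi * real j * real k / real p + \<phi>)) =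
     Re (dft p w j) \<cdot>\<^sub>v Matrix.vec p (\<lambda>k. cos (2 * pi * real j * real k / real p + \<phi>))"
  by (rule eq_vecI)
    (simp_all add: convolution_matrix_def scalar_prod_def atLeast0LessThan filter_convolve_cos)

lemma convolution_matrix_mult_fourier_matrix:
  "map_mat complex_of_real (convolution_matrix p w) * fourier_matrix p =
     fourier_matrix p * dft_diagonal p w"
proof (rule eq_matI)
  fix i j assume "i < dim_row (fourier_matrix p * dft_diagonal p w)"
    "j < dim_col (fourier_matrix p * dft_diagonal p w)"
  then have ij: "i < p" "j < p"
    by (simp_all add: fourier_matrix_def dft_diagonal_def mat_diag_def)
  have "(map_mat complex_of_real (convolution_matrix p w) * fourier_matrix p) $$ (i, j) =
      (\<Sum>k<p. complex_of_real (w (int i - int k)) * fourier_mode p j (int k)) /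
        complex_of_real (sqrt (real p))"
    using ij by (simp add: convolution_matrix_def fourier_matrix_eq scalar_prod_def
        atLeast0LessThan sum_divide_distrib)
  also have "\<dots> = dft p w j * fourier_mode p j (int i) / complex_of_real (sqrt (real p))"
    unfolding sum_lessThan_int[of "\<lambda>k. complex_of_real (w (int i - k)) * fourier_mode p j k"]
      filter_convolve_mode ..
  also have "\<dots> = (fourier_matrix p * dft_diagonal p w) $$ (i, j)"
    unfolding dft_diagonal_def mat_diag_mult_right[OF fourier_matrix_carrier]
    using ij by (simp add: fourier_matrix_eq)
  finally show "(map_mat complex_of_real (convolution_matrix p w) * fourier_matrix p) $$ (i, j) =
      (fourier_matrix p * dft_diagonal p w) $$ (i, j)" .
qed (simp_all add: convolution_matrix_def fourier_matrix_def dft_diagonal_def mat_diag_def)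

text \<open>Packaged as a similarity witness because similarity passes to powers, which gives the
  spectral formula for the iterates.\<close>

lemma one_minus_convolution_matrix_similar:
  "similar_mat_wit (map_mat complex_of_real (1\<^sub>m p - convolution_matrix p w))
     (1\<^sub>m p - dft_diagonal p w) (fourier_matrix p) (mat_adjoint (fourier_matrix p))"
proof -
  define U D V W where "U = fourier_matrix p" and "D = dft_diagonal p w"
    and "V = mat_adjoint U" and "W = map_mat complex_of_real (convolution_matrix p w)"
  note defs = U_def D_def V_def W_def
  have U: "U \<in> carrier_mat p p" and D: "D \<in> carrier_mat p p" and V: "V \<in> carrier_mat p p"
    and W: "W \<in> carrier_mat p p"
    by (simp_all add: defs dft_diagonal_def mat_adjoint_carrier convolution_matrix_carrier)
  have VU: "V * U = 1\<^sub>m p" using fourier_matrix_unitary[OF p] by (simp add: defs)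
  \<comment> \<open>For square matrices a left inverse is also a right inverse.\<close>
  then have UV: "U * V = 1\<^sub>m p" using mat_mult_left_right_inverse[OF V U] by simp
  have WU: "W * U = U * D" by (simp add: defs convolution_matrix_mult_fourier_matrix)
  have "U * (1\<^sub>m p - D) * V = (1\<^sub>m p - W) * U * V"
    using U D W by (simp add: mult_minus_distrib_mat[of _ p p _ p] minus_mult_distrib_mat[of _ p p _ _ p] WU)
  also have "\<dots> = 1\<^sub>m p - W"
    using U V W UV by (simp add: assoc_mult_mat[of _ p p _ p _ p] minus_carrier_mat)
  also have "\<dots> = map_mat complex_of_real (1\<^sub>m p - convolution_matrix p w)"
    by (rule eq_matI) (auto simp: W_def convolution_matrix_def)
  finally have "map_mat complex_of_real (1\<^sub>m p - convolution_matrix p w) = U * (1\<^sub>m p - D) * V" ..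
  with UV VU U V D show ?thesis
    unfolding defs[symmetric]
    by (intro similar_mat_witI[of _ _ p]) (auto simp: minus_carrier_mat)
qed

lemma one_minus_convolution_matrix_power:
  assumes v: "v \<in> carrier_vec p"
  shows "map_vec complex_of_real (((1\<^sub>m p - convolution_matrix p w) ^\<^sub>m m) *\<^sub>v v) =
    (fourier_matrix p * ((1\<^sub>m p - dft_diagonal p w) ^\<^sub>m m) * mat_adjoint (fourier_matrix p)) *\<^sub>v
      map_vec complex_of_real v"
proof -
  have A: "1\<^sub>m p - convolution_matrix p w \<in> carrier_mat p p"
    by (simp add: minus_carrier_mat convolution_matrix_carrier)
  show ?thesis
    using similar_mat_witD(3)[OF refl
        similar_mat_wit_pow[OF one_minus_convolution_matrix_similar, of m]]
    unfolding of_real_hom.mult_mat_vec_hom[OF pow_carrier_mat[OF A] v] of_real_hom.mat_hom_pow[OF A]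
    by simp
qed

end

text \<open>The DFT of \<open>w\<close> is the square of the DFT of the generating filter
  \<open>h\<close>, and the latter is real.\<close>

lemma dft_doubly_convolved_nonneg:
  assumes "p > 0" "doubly_convolved p w"
  shows "0 \<le> Re (dft p w j)"
proof -
  from assms(2) obtain h where h: "discrete_periodic_filter p h" "w = circular_convolution p h h"
    by (auto simp: doubly_convolved_def)
  have "dft p w j = (complex_of_real (Re (dft p h j)))\<^sup>2"
    unfolding dft_filter_real[OF assms(1) h(1), symmetric] h(2)
    by (rule dft_self_convolution[OF assms(1) h(1)])
  then show ?thesis by (simp flip: of_real_power)
qed

section \<open>Matrix powers on eigenvectors and scaling of the Euclidean norm\<close>

lemma pow_mat_mult_eigenvector:
  fixes A :: "'a :: field mat"
  assumes A: "A \<in> carrier_mat n n" and v: "v \<in> carrier_vec n" and "A *\<^sub>v v = c \<cdot>\<^sub>v v"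
  shows "(A ^\<^sub>m m) *\<^sub>v v = c ^ m \<cdot>\<^sub>v v"
proof (induction m)
  case 0
  then show ?case using A v by auto
next
  case (Suc m)
  have "(A ^\<^sub>m Suc m) *\<^sub>v v = (A ^\<^sub>m m) *\<^sub>v (c \<cdot>\<^sub>v v)"
    using assoc_mult_mat_vec[OF pow_carrier_mat[OF A] A v] assms(3) by simp
  also have "\<dots> = c \<cdot>\<^sub>v ((A ^\<^sub>m m) *\<^sub>v v)"
    by (rule mult_mat_vec[OF pow_carrier_mat[OF A] v])
  finally show ?case by (simp add: Suc.IH smult_smult_assoc)
qed

lemma euclidean_norm_smult: "euclidean_norm (c \<cdot>\<^sub>v v) = \<bar>c\<bar> * euclidean_norm v"
proof -
  have "euclidean_norm (c \<cdot>\<^sub>v v) = sqrt (\<Sum>i<dim_vec v. (\<bar>c\<bar> * v $ i)\<^sup>2)"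
    by (simp add: euclidean_norm_def L2_set_def power_mult_distrib)
  also have "\<dots> = \<bar>c\<bar> * euclidean_norm v"
    by (simp add: euclidean_norm_def L2_set_def power_mult_distrib real_sqrt_mult
        sum_distrib_left[symmetric])
  finally show ?thesis .
qed

section \<open>Convergence of the iterates for the two-tone signal\<close>

theorem corollary3:
  fixes n p L :: nat
    and T a \<phi> f \<eta> \<delta> :: real
    and w :: "int \<Rightarrow> real"
    and s s\<^sub>H\<^sub>F :: "real vec"
    and W :: "real mat"
    and U D :: "complex mat"
  assumes "T > 0" and "1 / T \<in> \<nat>" and "T < 1 / 2"
    and "real p = real n / T"
    and "f \<in> (\<lambda>k. real k / real n) ` {1..<n}"
    and "s = Matrix.vec p (\<lambda>k. cos (2 * pi * (real k * T)) + a * cos (2 * pi * f * (real k * T) + \<phi>))"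
    and "s\<^sub>H\<^sub>F = Matrix.vec p (\<lambda>k. cos (2 * pi * (real k * T)))"
    and "discrete_periodic_filter p w"
    and "has_filter_length p L w"
    and "doubly_convolved p w"
    and "W = convolution_matrix p w"
    and "U = fourier_matrix p"
    and "D = dft_diagonal p w"
    and "dft p w n = 0"
    and "\<And>j. 1 \<le> j \<Longrightarrow> j < n \<Longrightarrow> dft p w j \<noteq> 0"
    and "\<eta> > 0" and "\<delta> > 0"
  shows "\<exists>N\<^sub>0 > 0.
    (\<forall>m \<ge> N\<^sub>0. euclidean_norm
       (((1\<^sub>m p - W) ^\<^sub>m (m + 1)) *\<^sub>v s - ((1\<^sub>m p - W) ^\<^sub>m m) *\<^sub>v s) < \<delta>) \<and>
    (let IMF\<^sub>1 = ((1\<^sub>m p - W) ^\<^sub>m N\<^sub>0) *\<^sub>v s in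
       map_vec complex_of_real IMF\<^sub>1 =
         (U * ((1\<^sub>m p - D) ^\<^sub>m N\<^sub>0) * mat_adjoint U) *\<^sub>v map_vec complex_of_real s \<and>
       euclidean_norm (IMF\<^sub>1 - s\<^sub>H\<^sub>F) < \<eta>)"
proof -
  from assms(5) obtain j where j: "1 \<le> j" "j < n" and f: "f = real j / real n"
    by auto
  have "real p > 0" using assms(1,4) j by simp
  then have p: "p > 0" by simp
  \<comment> \<open>Sample times become \<open>k * n / p\<close>, so frequency 1 has DFT index
    \<open>n\<close> and frequency \<open>f = j / n\<close> has index \<open>j\<close>.\<close>
  have T: "T = real n / real p" using assms(1,4) p by (simp add: field_simps)
  define wave where
    "wave l \<psi> = Matrix.vec p (\<lambda>k. cos (2 * pi * real l * real k / real p + \<psi>))" for l :: nat and \<psi>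
  have wave: "wave l \<psi> \<in> carrier_vec p" for l \<psi> by (simp add: wave_def)
  define c where "c = Re (dft p w j)"
  \<comment> \<open>A nonzero complex number may have real part 0; realness of the DFT rules this
    out.\<close>
  have "c \<noteq> 0"
    using assms(15)[OF j] dft_filter_real[OF p assms(8), of j] by (auto simp: c_def)
  then have c: "0 < c" "c \<le> 1"
    using dft_doubly_convolved_nonneg[OF p assms(10), of j] dft_filter_le_1[OF p assms(8), of j]
    by (auto simp: c_def)
  have s: "s = wave n 0 + a \<cdot>\<^sub>v wave j \<phi>"
    using j p by (auto simp: assms(6) wave_def T f mult_ac)
  have sHF: "s\<^sub>H\<^sub>F = wave n 0"
    using p by (auto simp: assms(7) wave_def T mult_ac)
  have A: "1\<^sub>m p - W \<in> carrier_mat p p"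
    by (simp add: assms(11) minus_carrier_mat convolution_matrix_carrier[OF p assms(8)])
  have eigen: "((1\<^sub>m p - W) ^\<^sub>m m) *\<^sub>v wave l \<psi> = (1 - Re (dft p w l)) ^ m \<cdot>\<^sub>v wave l \<psi>" for m l \<psi>
  proof (rule pow_mat_mult_eigenvector[OF A wave])
    have "(1\<^sub>m p - W) *\<^sub>v wave l \<psi> = 1\<^sub>m p *\<^sub>v wave l \<psi> - W *\<^sub>v wave l \<psi>"
      by (rule minus_mult_distrib_mat_vec[OF one_carrier_mat _ wave])
        (simp add: assms(11) convolution_matrix_carrier[OF p assms(8)])
    also have "\<dots> = wave l \<psi> - Re (dft p w l) \<cdot>\<^sub>v wave l \<psi>"
      using convolution_matrix_mult_cos[OF p assms(8)] wave[of l \<psi>]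
      by (simp add: wave_def assms(11))
    also have "\<dots> = (1 - Re (dft p w l)) \<cdot>\<^sub>v wave l \<psi>"
      by (rule eq_vecI) (simp_all add: algebra_simps)
    finally show "(1\<^sub>m p - W) *\<^sub>v wave l \<psi> = (1 - Re (dft p w l)) \<cdot>\<^sub>v wave l \<psi>" .
  qed
  \<comment> \<open>At index \<open>n\<close> the eigenvalue of \<open>W\<close> is 0, so that tone
    has factor \<open>1 ^ m\<close>; only the slow tone decays.\<close>
  have iterate: "((1\<^sub>m p - W) ^\<^sub>m m) *\<^sub>v s = s\<^sub>H\<^sub>F + ((1 - c) ^ m * a) \<cdot>\<^sub>v wave j \<phi>" for m
    using mult_mat_vec[OF pow_carrier_mat[OF A, of m] wave[of j \<phi>], of a]
      mult_add_distrib_mat_vec[OF pow_carrier_mat[OF A, of m] wave[of n 0], of "a \<cdot>\<^sub>v wave j \<phi>"]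
      wave[of j \<phi>]
    by (simp add: s sHF eigen assms(14) c_def smult_smult_assoc mult.commute)
  define K where "K = \<bar>a\<bar> * euclidean_norm (wave j \<phi>)"
  have "(\<lambda>m. (1 - c) ^ m * K) \<longlonglongrightarrow> 0 * K"
    using c by (intro tendsto_mult LIMSEQ_realpow_zero tendsto_const) auto
  \<comment> \<open>\<open>(1 - c) ^ m * K\<close> is the norm of the remaining slow tone; the
    minimum lets one threshold serve both the stopping criterion and the accuracy.\<close>
  then have "\<forall>\<^sub>F m in sequentially. (1 - c) ^ m * K < min \<delta> \<eta>"
    using assms(16,17) by (intro order_tendstoD) auto
  then obtain N where N: "\<And>m. m \<ge> N \<Longrightarrow> (1 - c) ^ m * K < min \<delta> \<eta>"
    by (auto simp: eventually_sequentially)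
  \<comment> \<open>The witness is \<open>Suc N\<close>, which is positive even if
    \<open>N = 0\<close>. Successive powers of \<open>1 - c\<close> differ by
    \<open>- c * (1 - c) ^ m\<close>, and \<open>c \<le> 1\<close> bounds the increment by the
    remaining slow tone.\<close>
  have step: "euclidean_norm (((1\<^sub>m p - W) ^\<^sub>m (m + 1)) *\<^sub>v s - ((1\<^sub>m p - W) ^\<^sub>m m) *\<^sub>v s) < \<delta>"
    if "m \<ge> Suc N" for m
  proof -
    have "((1\<^sub>m p - W) ^\<^sub>m (m + 1)) *\<^sub>v s - ((1\<^sub>m p - W) ^\<^sub>m m) *\<^sub>v s =
        (- c * (1 - c) ^ m * a) \<cdot>\<^sub>v wave j \<phi>"
      unfolding iterate
      by (rule eq_vecI) (simp_all add: sHF wave_def algebra_simps)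
    then have "euclidean_norm (((1\<^sub>m p - W) ^\<^sub>m (m + 1)) *\<^sub>v s - ((1\<^sub>m p - W) ^\<^sub>m m) *\<^sub>v s) =
        c * ((1 - c) ^ m * K)"
      using c by (simp add: euclidean_norm_smult K_def abs_mult)
    also have "\<dots> \<le> 1 * ((1 - c) ^ m * K)"
      using c by (intro mult_right_mono) (auto simp: K_def euclidean_norm_def)
    also have "\<dots> < \<delta>" using N[of m] that by simp
    finally show ?thesis .
  qed
  have "((1\<^sub>m p - W) ^\<^sub>m Suc N) *\<^sub>v s - s\<^sub>H\<^sub>F = ((1 - c) ^ Suc N * a) \<cdot>\<^sub>v wave j \<phi>"
    unfolding iterate by (rule eq_vecI) (simp_all add: sHF wave_def)
  then have "euclidean_norm (((1\<^sub>m p - W) ^\<^sub>m Suc N) *\<^sub>v s - s\<^sub>H\<^sub>F) = (1 - c) ^ Suc N * K"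
    using c by (simp add: euclidean_norm_smult K_def abs_mult)
  also have "\<dots> < \<eta>" using N[of "Suc N"] by simp
  finally have close: "euclidean_norm (((1\<^sub>m p - W) ^\<^sub>m Suc N) *\<^sub>v s - s\<^sub>H\<^sub>F) < \<eta>" .
  \<comment> \<open>The spectral formula is stated over the complex numbers, so the real iterate is
    embedded there.\<close>
  have "s \<in> carrier_vec p" by (simp add: assms(6))
  then have "map_vec complex_of_real (((1\<^sub>m p - W) ^\<^sub>m Suc N) *\<^sub>v s) =
      (U * ((1\<^sub>m p - D) ^\<^sub>m Suc N) * mat_adjoint U) *\<^sub>v map_vec complex_of_real s"
    unfolding assms(11-13) by (rule one_minus_convolution_matrix_power[OF p assms(8)])
  with step close show ?thesis
    unfolding Let_def by (intro exI[of _ "Suc N"]) blast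
qed

end
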